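(* Let $\mathcal M,\mathcal X,f,x_*,\mu,L,K$ satisfy the standing assumption in the context, and let $x_0,\alpha,\beta,\gamma$ be the initial point and parameters of the LORAG algorithm. Put $$E_0=f(x_0)-f(x_* )+\frac\gamma2\|\log_{x_0}(x_* )\|^2,\quad R_1=\Bigl(\frac{2E_0}{\gamma}\Bigr)^{1/2},\quad R_2=\max\Bigl\{2R_1,\Bigl(1+\frac{\alpha L}{(1+\beta)\gamma}\Bigr)R_1\Bigr\}.$$ Suppose that $(1+2KR_1^2)^2\le1+\beta$ and $$\{x\in\mathcal M: f(x)\le f(x_0)\}\subset\mathcal B_{R_1}\subset\mathcal B_{R_2}\subset\mathcal X.$$ Then the iterates $\{x_m\}$ of the LORAG algorithm lie in $\mathcal B_{R_1}\subset\mathcal X$.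
   Context: Standing assumption. $\mathcal M$ is a Riemannian manifold with exponential maps $\exp_x$ and logarithmic maps $\log_x=\exp_x^{-1}$ (so $\|\log_x(y)\|$ is the distance from $x$ to $y$); $f:\mathcal M\to\mathbb{R}$ is smooth with minimizer $x_*=\arg\min_{x\in\mathcal M}f(x)$. $\mathcal X\subset\mathcal M$ is geodesically convex (any two points of $\mathcal X$ are joined by a geodesic contained in $\mathcal X$), the sectional curvature on $\mathcal X$ is bounded in $[-K,K]$, $x_*\in\mathcal X$, and $f$ is $\mu$-geodesically convex and $L$-Lipschitz smooth on $\mathcal X$ with $\mu,L>0$, i.e. for all $x,y\in\mathcal X$, $\frac\mu2\|\log_x(y)\|^2\le f(y)-f(x)-\langle\mathrm{grad}f(x),\log_x(y)\rangle\le\frac L2\|\log_x(y)\|^2$. With $\mathcal B_R=\{x\in\mathcal M:\|\log_{x_*}(x)\|\le R\}$, for any $R>0$, if $\mathcal B_R\subset\mathcal X$ then $\mathcal B_R$ is geodesically convex. LORAG algorithm (Locally Optimal Riemannian Accelerated Gradient). Input $x_0$, $\beta>0$, $\mu$, $L$. Choose $0<\alpha\le\frac{\sqrt{\beta^2+4(1+\beta)\mu/L}-\beta}{2}$, set $\gamma=\frac{\alpha\mu}{\alpha+\beta}$, $\overline\gamma=(1+\beta)\gamma$, $v_0=x_0$. For $m=0,1,2,\dots$: $$y_m=\exp_{x_m}\Bigl(\tfrac{\alpha}{1+\alpha+\beta}\log_{x_m}(v_m)\Bigr),\qquad v_{m+1}=\exp_{y_m}\Bigl(\tfrac{1-\alpha}{1+\beta}\log_{y_m}(v_m)-\tfrac{\alpha}{\overline\gamma}\mathrm{grad}f(y_m)\Bigr),$$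 and $x_{m+1}=\exp_{y_m}(g_m)$, where $g_m$ minimizes $f(\exp_{y_m}(g))$ over $g\in\mathrm{span}\{\mathrm{grad}f(y_m),\log_{y_m}(x_m)\}$. *)

theory Defs
  imports "HOL-Analysis.Analysis"
begin

section \<open>Smooth functions between Euclidean spaces\<close>

text \<open>To be used on open sets only.\<close>

fun Ck_on :: "nat \<Rightarrow> 'a::euclidean_space set \<Rightarrow> ('a \<Rightarrow> 'b::real_normed_vector) \<Rightarrow> bool" where
  "Ck_on 0 S f \<longleftrightarrow> continuous_on S f"
| "Ck_on (Suc k) S f \<longleftrightarrow>
     (\<forall>p\<in>S. f differentiable (at p)) \<and>
     (\<forall>u. Ck_on k S (\<lambda>p. frechet_derivative f (at p) u))"

definition smooth_on :: "'a::euclidean_space set \<Rightarrow> ('a \<Rightarrow> 'b::real_normed_vector) \<Rightarrow> bool" where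
  "smooth_on S f \<longleftrightarrow> (\<forall>k. Ck_on k S f)"


section \<open>Riemannian manifolds\<close>

text \<open>
  The manifold is the whole type \<open>'m\<close>, its model space is \<open>'e\<close>. A chart is a pair of its domain
  and its coordinate map, whose values outside the domain are irrelevant.
  As there are no dependent types, a tangent vector at \<open>x\<close> is represented by its coordinates
  with respect to a chart \<open>chart_at M x\<close> around \<open>x\<close> that is fixed once and for all. So every tangent
  space has the underlying vector space \<open>'e\<close>, but elements of different tangent spaces are
  unrelated; \<open>metric M x\<close> is the inner product on the tangent space at \<open>x\<close>.
\<close>

type_synonym ('m, 'e) chart = "'m set \<times> ('m \<Rightarrow> 'e)"

record ('m, 'e) riem =
  atlas :: "('m, 'e) chart set"
  chart_at :: "'m \<Rightarrow> ('m, 'e) chart"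
  metric :: "'m \<Rightarrow> 'e \<Rightarrow> 'e \<Rightarrow> real"

definition chart_inv :: "('m, 'e) chart \<Rightarrow> 'e \<Rightarrow> 'm" where
  "chart_inv c = inv_into (fst c) (snd c)"

definition chart_image :: "('m, 'e) chart \<Rightarrow> 'e set" where
  "chart_image c = snd c ` fst c"

definition is_chart :: "('m::topological_space, 'e::euclidean_space) chart \<Rightarrow> bool" where
  "is_chart c \<longleftrightarrow> open (fst c) \<and> open (chart_image c) \<and>
     homeomorphism (fst c) (chart_image c) (snd c) (chart_inv c)"

definition transition :: "('m, 'e) chart \<Rightarrow> ('m, 'e) chart \<Rightarrow> 'e \<Rightarrow> 'e" where
  "transition c c' = (\<lambda>p. snd c' (chart_inv c p))"

text \<open>The matrix \<open>(g\<^sub>i\<^sub>j)\<close> of the metric in the chart \<open>c\<close> at the coordinates \<open>p\<close>, as a bilinear form.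
  The transition map turns coordinates in \<open>c\<close> into coordinates in the chart representing the
  tangent space.\<close>

definition coord_metric ::
    "('m, 'e::euclidean_space) riem \<Rightarrow> ('m, 'e) chart \<Rightarrow> 'e \<Rightarrow> 'e \<Rightarrow> 'e \<Rightarrow> real" where
  "coord_metric M c p u v =
     (let x = chart_inv c p; T = frechet_derivative (transition c (chart_at M x)) (at p)
      in metric M x (T u) (T v))"

definition riemannian_manifold ::
    "('m::{t2_space, second_countable_topology}, 'e::euclidean_space) riem \<Rightarrow> bool" where
  "riemannian_manifold M \<longleftrightarrow>
     (\<forall>c\<in>atlas M. is_chart c) \<and>
     (\<forall>c\<in>atlas M. \<forall>c'\<in>atlas M. smooth_on (snd c ` (fst c \<inter> fst c')) (transition c c')) \<and>
     (\<forall>x. chart_at M x \<in> atlas M \<and> x \<in> fst (chart_at M x)) \<and>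
     (\<forall>x. bilinear (metric M x) \<and>
          (\<forall>u v. metric M x u v = metric M x v u) \<and>
          (\<forall>u. u \<noteq> 0 \<longrightarrow> metric M x u u > 0)) \<and>
     (\<forall>c\<in>atlas M. \<forall>u v. smooth_on (chart_image c) (\<lambda>p. coord_metric M c p u v))"

definition rnorm :: "('m, 'e) riem \<Rightarrow> 'm \<Rightarrow> 'e \<Rightarrow> real" where
  "rnorm M x u = sqrt (metric M x u u)"


section \<open>Smooth functions and gradients\<close>

definition smooth_fun :: "('m, 'e::euclidean_space) riem \<Rightarrow> ('m \<Rightarrow> real) \<Rightarrow> bool" where
  "smooth_fun M f \<longleftrightarrow> (\<forall>c\<in>atlas M. smooth_on (chart_image c) (\<lambda>p. f (chart_inv c p)))"

definition differential :: "('m, 'e::euclidean_space) riem \<Rightarrow> ('m \<Rightarrow> real) \<Rightarrow> 'm \<Rightarrow> 'e \<Rightarrow> real" where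
  "differential M f x =
     frechet_derivative (\<lambda>p. f (chart_inv (chart_at M x) p)) (at (snd (chart_at M x) x))"

definition grad :: "('m, 'e::euclidean_space) riem \<Rightarrow> ('m \<Rightarrow> real) \<Rightarrow> 'm \<Rightarrow> 'e" where
  "grad M f x = (THE w. \<forall>u. metric M x w u = differential M f x u)"


section \<open>Levi-Civita connection and sectional curvature\<close>

text \<open>\<open>christoffel M c p u v = \<Sum> \<Gamma>\<^sup>k\<^sub>i\<^sub>j u\<^sup>i v\<^sup>j e\<^sub>k\<close>, characterised by the Koszul formula
  for constant coordinate fields.\<close>

definition christoffel ::
    "('m, 'e::euclidean_space) riem \<Rightarrow> ('m, 'e) chart \<Rightarrow> 'e \<Rightarrow> 'e \<Rightarrow> 'e \<Rightarrow> 'e" where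
  "christoffel M c p u v = (THE z. \<forall>w. coord_metric M c p z w =
     (frechet_derivative (\<lambda>q. coord_metric M c q v w) (at p) u
      + frechet_derivative (\<lambda>q. coord_metric M c q u w) (at p) v
      - frechet_derivative (\<lambda>q. coord_metric M c q u v) (at p) w) / 2)"

text \<open>\<open>R(u,v)w = \<nabla>\<^sub>u\<nabla>\<^sub>v w - \<nabla>\<^sub>v\<nabla>\<^sub>u w\<close> for constant (hence commuting) coordinate fields.\<close>

definition curvature ::
    "('m, 'e::euclidean_space) riem \<Rightarrow> ('m, 'e) chart \<Rightarrow> 'e \<Rightarrow> 'e \<Rightarrow> 'e \<Rightarrow> 'e \<Rightarrow> 'e" where
  "curvature M c p u v w =
     frechet_derivative (\<lambda>q. christoffel M c q v w) (at p) u
     - frechet_derivative (\<lambda>q. christoffel M c q u w) (at p) v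
     + christoffel M c p u (christoffel M c p v w)
     - christoffel M c p v (christoffel M c p u w)"

definition sectional_curvature ::
    "('m, 'e::euclidean_space) riem \<Rightarrow> 'm \<Rightarrow> 'e \<Rightarrow> 'e \<Rightarrow> real" where
  "sectional_curvature M x u v =
     (let c = chart_at M x in
      metric M x (curvature M c (snd c x) u v v) u /
        (metric M x u u * metric M x v v - (metric M x u v)\<^sup>2))"

definition sectional_curvature_in ::
    "('m, 'e::euclidean_space) riem \<Rightarrow> 'm set \<Rightarrow> real set \<Rightarrow> bool" where
  "sectional_curvature_in M X I \<longleftrightarrow>
     (\<forall>x\<in>X. \<forall>u v. dim {u, v} = 2 \<longrightarrow> sectional_curvature M x u v \<in> I)"


section \<open>Geodesics, exponential map, distance, logarithm\<close>

text \<open>Here \<open>u\<close> is the velocity in the coordinates of \<open>c\<close>; it is constrained only where the curve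
  runs inside the domain of \<open>c\<close>. The geodesic equation is \<open>u' + \<Gamma>(u,u) = 0\<close>.\<close>

definition geodesic_on ::
    "('m::topological_space, 'e::euclidean_space) riem \<Rightarrow> real set \<Rightarrow> (real \<Rightarrow> 'm) \<Rightarrow> bool" where
  "geodesic_on M I \<gamma> \<longleftrightarrow> continuous_on I \<gamma> \<and>
     (\<forall>c\<in>atlas M. \<exists>u. \<forall>t\<in>I. \<gamma> t \<in> fst c \<longrightarrow>
        ((\<lambda>s. snd c (\<gamma> s)) has_vector_derivative u t) (at t within I) \<and>
        (u has_vector_derivative - christoffel M c (snd c (\<gamma> t)) (u t) (u t)) (at t within I))"

definition geodesic_from ::
    "('m::topological_space, 'e::euclidean_space) riem \<Rightarrow> 'm \<Rightarrow> 'e \<Rightarrow> (real \<Rightarrow> 'm) \<Rightarrow> bool" where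
  "geodesic_from M x u \<gamma> \<longleftrightarrow> geodesic_on M {0..1} \<gamma> \<and> \<gamma> 0 = x \<and>
     ((\<lambda>s. snd (chart_at M x) (\<gamma> s)) has_vector_derivative u) (at 0 within {0..1})"

text \<open>The manifold need not be complete, so the exponential map comes with its domain.\<close>

definition rexp_dom ::
    "('m::topological_space, 'e::euclidean_space) riem \<Rightarrow> 'm \<Rightarrow> 'e set" where
  "rexp_dom M x = {u. \<exists>\<gamma>. geodesic_from M x u \<gamma>}"

definition rexp ::
    "('m::topological_space, 'e::euclidean_space) riem \<Rightarrow> 'm \<Rightarrow> 'e \<Rightarrow> 'm" where
  "rexp M x u = (THE y. \<exists>\<gamma>. geodesic_from M x u \<gamma> \<and> \<gamma> 1 = y)"

definition geodesically_convex ::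
    "('m::topological_space, 'e::euclidean_space) riem \<Rightarrow> 'm set \<Rightarrow> bool" where
  "geodesically_convex M X \<longleftrightarrow> (\<forall>p\<in>X. \<forall>q\<in>X. \<exists>\<gamma>. geodesic_on M {0..1} \<gamma> \<and>
     \<gamma> 0 = p \<and> \<gamma> 1 = q \<and> \<gamma> ` {0..1} \<subseteq> X)"

definition piecewise_C1_curve ::
    "('m::topological_space, 'e::euclidean_space) riem \<Rightarrow> (real \<Rightarrow> 'm) \<Rightarrow> bool" where
  "piecewise_C1_curve M \<gamma> \<longleftrightarrow> continuous_on {0..1} \<gamma> \<and>
     (\<exists>S. finite S \<and> (\<forall>c\<in>atlas M.
        (\<lambda>s. snd c (\<gamma> s)) C1_differentiable_on {t \<in> {0<..<1} - S. \<gamma> t \<in> fst c}))"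

definition speed :: "('m, 'e::euclidean_space) riem \<Rightarrow> (real \<Rightarrow> 'm) \<Rightarrow> real \<Rightarrow> real" where
  "speed M \<gamma> t = rnorm M (\<gamma> t) (vector_derivative (\<lambda>s. snd (chart_at M (\<gamma> t)) (\<gamma> s)) (at t))"

definition rdist ::
    "('m::topological_space, 'e::euclidean_space) riem \<Rightarrow> 'm \<Rightarrow> 'm \<Rightarrow> real" where
  "rdist M x y = Inf {l. \<exists>\<gamma>. piecewise_C1_curve M \<gamma> \<and> \<gamma> 0 = x \<and> \<gamma> 1 = y \<and>
     (speed M \<gamma> has_integral l) {0..1}}"

text \<open>Logarithms invert the exponential map and realise the distance. Where \<open>y\<close> is reached from
  \<open>x\<close> by a unique minimising geodesic, this determines \<open>lg x y\<close>; on cut loci, where the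
  exponential map is not injective, \<open>lg\<close> is an arbitrary selection.\<close>

definition is_log_map ::
    "('m::topological_space, 'e::euclidean_space) riem \<Rightarrow> ('m \<Rightarrow> 'm \<Rightarrow> 'e) \<Rightarrow> bool" where
  "is_log_map M lg \<longleftrightarrow> (\<forall>x y. lg x y \<in> rexp_dom M x \<and> rexp M x (lg x y) = y \<and>
     rnorm M x (lg x y) = rdist M x y)"

definition log_ball :: "('m, 'e) riem \<Rightarrow> ('m \<Rightarrow> 'm \<Rightarrow> 'e) \<Rightarrow> 'm \<Rightarrow> real \<Rightarrow> 'm set" where
  "log_ball M lg z R = {x. rnorm M z (lg z x) \<le> R}"

definition strongly_convex_smooth_on ::
    "('m, 'e::euclidean_space) riem \<Rightarrow> ('m \<Rightarrow> 'm \<Rightarrow> 'e) \<Rightarrow> 'm set \<Rightarrow> ('m \<Rightarrow> real) \<Rightarrow> real \<Rightarrow> real \<Rightarrow> bool"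
where
  "strongly_convex_smooth_on M lg X f \<mu> L \<longleftrightarrow> (\<forall>x\<in>X. \<forall>y\<in>X.
     \<mu> / 2 * (rnorm M x (lg x y))\<^sup>2 \<le> f y - f x - metric M x (grad M f x) (lg x y) \<and>
     f y - f x - metric M x (grad M f x) (lg x y) \<le> L / 2 * (rnorm M x (lg x y))\<^sup>2)"


section \<open>The LORAG algorithm\<close>

text \<open>Sequences \<open>x\<close>, \<open>y\<close>, \<open>v\<close> form a run if they satisfy the recursion. The minimiser defining
  \<open>x (Suc m)\<close> need not be unique, hence a relation and not a function. The memberships in
  \<open>rexp_dom\<close> express that the exponentials are defined; they always hold if the
  manifold is complete.\<close>

definition lorag_gamma :: "real \<Rightarrow> real \<Rightarrow> real \<Rightarrow> real" where
  "lorag_gamma \<alpha> \<beta> \<mu> = \<alpha> * \<mu> / (\<alpha> + \<beta>)"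

definition lorag_run ::
    "('m::topological_space, 'e::euclidean_space) riem \<Rightarrow> ('m \<Rightarrow> 'm \<Rightarrow> 'e) \<Rightarrow> ('m \<Rightarrow> real) \<Rightarrow>
     real \<Rightarrow> real \<Rightarrow> real \<Rightarrow> 'm \<Rightarrow> (nat \<Rightarrow> 'm) \<Rightarrow> (nat \<Rightarrow> 'm) \<Rightarrow> (nat \<Rightarrow> 'm) \<Rightarrow> bool" where
  "lorag_run M lg f \<alpha> \<beta> \<mu> x0 x y v \<longleftrightarrow> x 0 = x0 \<and> v 0 = x0 \<and>
     (\<forall>m.
       let a = (\<alpha> / (1 + \<alpha> + \<beta>)) *\<^sub>R lg (x m) (v m);
           \<gamma>_bar = (1 + \<beta>) * lorag_gamma \<alpha> \<beta> \<mu>;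
           b = ((1 - \<alpha>) / (1 + \<beta>)) *\<^sub>R lg (y m) (v m) - (\<alpha> / \<gamma>_bar) *\<^sub>R grad M f (y m);
           D = span {grad M f (y m), lg (y m) (x m)} \<inter> rexp_dom M (y m)
       in a \<in> rexp_dom M (x m) \<and> y m = rexp M (x m) a \<and>
          b \<in> rexp_dom M (y m) \<and> v (Suc m) = rexp M (y m) b \<and>
          (\<exists>g. is_arg_min (\<lambda>h. f (rexp M (y m) h)) (\<lambda>h. h \<in> D) g \<and>
               x (Suc m) = rexp M (y m) g))"

end

theory Submission
  imports Defs
begin

text \<open>
  The previous iterate \<open>x\<^sub>m = exp\<^bsub>y\<^sub>m\<^esub>(log\<^bsub>y\<^sub>m\<^esub> x\<^sub>m)\<close> is itself a candidate in the minimisation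
  over \<open>span {grad f(y\<^sub>m), log\<^bsub>y\<^sub>m\<^esub> x\<^sub>m}\<close>, so \<open>f\<close> never increases along a run and the iterates
  never leave the sublevel set of the initial point.
\<close>

lemma lorag_run_descent:
  assumes "is_log_map M lg" and "lorag_run M lg f \<alpha> \<beta> \<mu> x0 x y v"
  shows "f (x (Suc m)) \<le> f (x m)"
proof -
  let ?D = "span {grad M f (y m), lg (y m) (x m)} \<inter> rexp_dom M (y m)"
  obtain g where g: "is_arg_min (\<lambda>h. f (rexp M (y m) h)) (\<lambda>h. h \<in> ?D) g"
    and x: "x (Suc m) = rexp M (y m) g"
    using assms(2) unfolding lorag_run_def Let_def by blast
  \<comment> \<open>The vector is a generator of the span, and \<open>is_log_map\<close> puts it in
    the domain of the exponential at \<open>y m\<close>, wherever that point lies.\<close>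
  have "lg (y m) (x m) \<in> ?D" and "rexp M (y m) (lg (y m) (x m)) = x m"
    using assms(1) by (auto simp: is_log_map_def intro: span_base)
  with g x show ?thesis
    unfolding is_arg_min_linorder by metis
qed

text \<open>The one-step descents chain back to \<open>x 0 = x0\<close>, which bounds all iterates
  by one fixed value, as a sublevel set requires.\<close>

lemma lorag_run_sublevel:
  assumes "is_log_map M lg" and "lorag_run M lg f \<alpha> \<beta> \<mu> x0 x y v"
  shows "f (x m) \<le> f x0"
proof (induction m)
  case 0
  then show ?case
    using assms(2) by (simp add: lorag_run_def)
next
  case (Suc m)
  then show ?case
    using lorag_run_descent[OF assms, of m] by linarith
qed

theorem theorem25:
  fixes M :: "('m::{t2_space, second_countable_topology}, 'e::euclidean_space) riem"
    and lg :: "'m \<Rightarrow> 'm \<Rightarrow> 'e"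
    and X :: "'m set"
    and f :: "'m \<Rightarrow> real"
    and xs x0 :: 'm
    and \<mu> L K \<alpha> \<beta> \<gamma> E0 R1 R2 :: real
    and x y v :: "nat \<Rightarrow> 'm"
  assumes "riemannian_manifold M"
    and "is_log_map M lg"
    and "smooth_fun M f"
    and "is_arg_min f (\<lambda>_. True) xs"
    and "geodesically_convex M X"
    and "sectional_curvature_in M X {-K..K}"
    and "xs \<in> X"
    and "\<mu> > 0" and "L > 0"
    and "strongly_convex_smooth_on M lg X f \<mu> L"
    and "\<And>R. R > 0 \<Longrightarrow> log_ball M lg xs R \<subseteq> X \<Longrightarrow> geodesically_convex M (log_ball M lg xs R)"
    and "\<beta> > 0" and "0 < \<alpha>"
    and "\<alpha> \<le> (sqrt (\<beta>\<^sup>2 + 4 * (1 + \<beta>) * \<mu> / L) - \<beta>) / 2"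
    and "\<gamma> = lorag_gamma \<alpha> \<beta> \<mu>"
    and "lorag_run M lg f \<alpha> \<beta> \<mu> x0 x y v"
    and "E0 = f x0 - f xs + \<gamma> / 2 * (rnorm M x0 (lg x0 xs))\<^sup>2"
    and "R1 = sqrt (2 * E0 / \<gamma>)"
    and "R2 = max (2 * R1) ((1 + \<alpha> * L / ((1 + \<beta>) * \<gamma>)) * R1)"
    and "(1 + 2 * K * R1\<^sup>2)\<^sup>2 \<le> 1 + \<beta>"
    and "{z. f z \<le> f x0} \<subseteq> log_ball M lg xs R1"
    and "log_ball M lg xs R1 \<subseteq> log_ball M lg xs R2"
    and "log_ball M lg xs R2 \<subseteq> X"
  shows "(\<forall>m. x m \<in> log_ball M lg xs R1) \<and> log_ball M lg xs R1 \<subseteq> X"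
proof -
  \<comment> \<open>The assumed inclusion of the sublevel set in the ball turns the bound on values
    of \<open>f\<close> into a bound on the distance to \<open>xs\<close>.\<close>
  have "x m \<in> log_ball M lg xs R1" for m
    using lorag_run_sublevel[OF \<open>is_log_map M lg\<close> \<open>lorag_run M lg f \<alpha> \<beta> \<mu> x0 x y v\<close>]
      \<open>{z. f z \<le> f x0} \<subseteq> log_ball M lg xs R1\<close> by blast
  moreover have "log_ball M lg xs R1 \<subseteq> X"
    using \<open>log_ball M lg xs R1 \<subseteq> log_ball M lg xs R2\<close> \<open>log_ball M lg xs R2 \<subseteq> X\<close> by (rule subset_trans)
  ultimately show ?thesis by blast
qed

end
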